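(* With an adversarially chosen initial coloring but uniformly random choice of conflicted vertices, the Persistent Decentralized Coloring algorithm requires $\Omega(n\Delta)$ expected recolorings in the worst case: there is an absolute constant $c>0$ such that for every $\Delta\ge 2$ there exist a graph $G$ with $n$ vertices and maximum degree $\Delta$ and an initial coloring $\chi_0:V(G)\to\{1,\dots,\Delta+1\}$ for which the expected number of recolorings performed by the algorithm started from $\chi_0$ is at least $c\,n\Delta$.
   Context: A vertex $v$ is conflicted under a coloring $\chi$ if some neighbor $u$ of $v$ has $\chi(u)=\chi(v)$. The Persistent Decentralized Coloring algorithm with a given initial coloring $\chi_0$ works as follows: at each time step a vertex $v$ is chosen uniformly at random among all currently conflicted vertices; while $v$ is conflicted, $v$ repeatedly changes its color to an independent uniformly random color in $\{1,\dots,\Delta+1\}$ (each change is one recoloring); this repeats until no vertex is conflicted. The expectation is over the random choices of conflicted vertices and the random new colors. *)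

theory Defs
  imports "HOL-Probability.Probability"
begin

definition finite_simple_graph :: "'a set \<Rightarrow> 'a set set \<Rightarrow> bool" where
  "finite_simple_graph V E \<longleftrightarrow> finite V \<and> (\<forall>e\<in>E. e \<subseteq> V \<and> card e = 2)"

definition neighbours :: "'a set set \<Rightarrow> 'a \<Rightarrow> 'a set" where
  "neighbours E v = {u. {u, v} \<in> E}"

(* The inserted 0 only makes the maximum well defined when V is empty. *)
definition max_degree :: "'a set \<Rightarrow> 'a set set \<Rightarrow> nat" where
  "max_degree V E = Max (insert 0 ((\<lambda>v. card (neighbours E v)) ` V))"

definition conflicted :: "'a set set \<Rightarrow> ('a \<Rightarrow> nat) \<Rightarrow> 'a \<Rightarrow> bool" where
  "conflicted E f v \<longleftrightarrow> (\<exists>u\<in>neighbours E v. f u = f v)"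

(* While v is conflicted, give it a fresh uniform color; the second result counts the recolorings.
   A recoloring is counted even when the drawn color equals the current one. *)
partial_function (spmf) recolor_vertex ::
    "'a set set \<Rightarrow> nat \<Rightarrow> 'a \<Rightarrow> ('a \<Rightarrow> nat) \<Rightarrow> (('a \<Rightarrow> nat) \<times> nat) spmf" where
  "recolor_vertex E \<Delta> v f =
     (if conflicted E f v then do {
        c \<leftarrow> spmf_of_set {1..\<Delta> + 1};
        (f', k) \<leftarrow> recolor_vertex E \<Delta> v (f(v := c));
        return_spmf (f', Suc k)
      } else return_spmf (f, 0))"

(* The result is the total number of recolorings performed. *)
partial_function (spmf) persistent_coloring ::
    "'a set \<Rightarrow> 'a set set \<Rightarrow> nat \<Rightarrow> ('a \<Rightarrow> nat) \<Rightarrow> nat spmf" where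
  "persistent_coloring V E \<Delta> f =
     (if \<exists>v\<in>V. conflicted E f v then do {
        v \<leftarrow> spmf_of_set {v\<in>V. conflicted E f v};
        (f', k) \<leftarrow> recolor_vertex E \<Delta> v f;
        m \<leftarrow> persistent_coloring V E \<Delta> f';
        return_spmf (k + m)
      } else return_spmf 0)"

lemma recolor_vertex_result:
  "(f', k) \<in> set_spmf (recolor_vertex E \<Delta> v f) \<Longrightarrow> (\<exists>c. f' = f(v := c)) \<and> \<not> conflicted E f' v"
proof (induction arbitrary: f f' k rule: recolor_vertex.fixp_induct)
  case 1
  show ?case by simp
next
  case 2
  then show ?case by simp
next
  case (3 rec)
  show ?case
  proof (cases "conflicted E f v")
    case True
    with 3(2) obtain c k' where "(f', k') \<in> set_spmf (rec E \<Delta> v (f(v := c)))"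
      by (auto simp: set_bind_spmf)
    from 3(1)[OF this] show ?thesis by (metis fun_upd_upd)
  next
    case False
    with 3(2) show ?thesis by (auto simp del: fun_upd_apply intro: fun_upd_triv[symmetric])
  qed
qed

lemma lossless_recolor_vertex:
  assumes "finite (neighbours E v)" "card (neighbours E v) \<le> \<Delta>" "v \<notin> neighbours E v"
  shows "lossless_spmf (recolor_vertex E \<Delta> v f)"
proof -
  let ?C = "{1..\<Delta> + 1}"
  define w where "w d = weight_spmf (recolor_vertex E \<Delta> v (f(v := d)))" for d
  define B where "B = {c\<in>?C. conflicted E (f(v := c)) v}"
  define m where "m = (\<Sum>c\<in>?C. w c) / real (card ?C)"
  have step: "weight_spmf (recolor_vertex E \<Delta> v g) = (if conflicted E g v then m else 1)"
    if "\<exists>c. g = f(v := c)" for g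
  proof (cases "conflicted E g v")
    case True
    have eq: "recolor_vertex E \<Delta> v g = do {
        c \<leftarrow> spmf_of_set ?C;
        (f', k) \<leftarrow> recolor_vertex E \<Delta> v (g(v := c));
        return_spmf (f', Suc k)}"
      using True by (subst recolor_vertex.simps) simp
    have "weight_spmf (recolor_vertex E \<Delta> v g)
        = (\<integral>c. weight_spmf (recolor_vertex E \<Delta> v (g(v := c))) \<partial>measure_spmf (spmf_of_set ?C))"
      unfolding eq by (simp add: weight_bind_spmf o_def case_prod_beta)
    also have "\<dots> = (\<integral>c. w c \<partial>measure_spmf (spmf_of_set ?C))"
      using that by (auto simp: w_def)
    also have "\<dots> = m"
      unfolding m_def by (subst integral_spmf_of_set) auto
    finally show ?thesis using True by simp
  next
    case False
    then have "recolor_vertex E \<Delta> v g = return_spmf (g, 0)"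
      by (subst recolor_vertex.simps) simp
    with False show ?thesis by simp
  qed
  have w: "w c = (if conflicted E (f(v := c)) v then m else 1)" for c
    unfolding w_def by (rule step) blast
  have "B \<subseteq> f ` neighbours E v"
    using assms(3) by (auto simp: B_def conflicted_def)
  then have "card B \<le> \<Delta>"
    using assms(1,2) by (meson card_image_le card_mono finite_imageI le_trans)
  have m_sum: "m * real (\<Delta> + 1) = (\<Sum>c\<in>?C. w c)"
    by (simp add: m_def del: of_nat_Suc of_nat_add)
  have "(\<Sum>c\<in>?C. w c) = (\<Sum>c\<in>?C. (if c \<in> B then m else 1))"
    by (rule sum.cong) (auto simp: w B_def)
  also have "\<dots> = m * card B + (real (\<Delta> + 1) - card B)"
  proof -
    have "(\<Sum>c\<in>?C. (if c \<in> B then m else 1)) = (\<Sum>c\<in>?C. 1 + (if c \<in> B then m - 1 else 0))"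
      by (rule sum.cong) auto
    also have "\<dots> = real (\<Delta> + 1) + (\<Sum>c\<in>?C. (if c \<in> B then m - 1 else 0))"
      by (subst sum.distrib) simp
    also have "(\<Sum>c\<in>?C. (if c \<in> B then m - 1 else 0)) = (\<Sum>c\<in>?C \<inter> B. m - 1)"
      by (rule sum.inter_restrict[symmetric]) simp
    also have "?C \<inter> B = B" by (auto simp: B_def)
    finally show ?thesis by (simp add: algebra_simps)
  qed
  finally have "m * real (\<Delta> + 1) = m * card B + (real (\<Delta> + 1) - card B)"
    unfolding m_sum .
  then have "(m - 1) * (real (\<Delta> + 1) - card B) = 0"
    by (simp only: algebra_simps mult_1 add_0)
  moreover have "real (\<Delta> + 1) - card B \<noteq> 0"
    using \<open>card B \<le> \<Delta>\<close> by linarith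
  ultimately have "m = 1" by (metis mult_eq_0_iff eq_iff_diff_eq_0)
  moreover have "\<exists>c. f = f(v := c)"
    by (metis fun_upd_triv)
  ultimately show ?thesis
    using step[of f] by (simp add: lossless_spmf_def del: fun_upd_apply split: if_splits)
qed

lemma neighbours_finite_simple_graph:
  assumes "finite_simple_graph V E"
  shows "neighbours E v \<subseteq> V" "v \<notin> neighbours E v" "u \<in> neighbours E v \<longleftrightarrow> v \<in> neighbours E u"
  using assms by (auto simp: finite_simple_graph_def neighbours_def insert_commute card_2_iff)

lemma lossless_persistent_coloring:
  assumes G: "finite_simple_graph V E" and "max_degree V E \<le> \<Delta>"
  shows "lossless_spmf (persistent_coloring V E \<Delta> f)"
proof (induction "card {v\<in>V. conflicted E f v}" arbitrary: f rule: less_induct)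
  case less
  have fin: "finite V" using G by (simp add: finite_simple_graph_def)
  have "lossless_spmf (recolor_vertex E \<Delta> v g)" if "v \<in> V" for v g
  proof (rule lossless_recolor_vertex)
    show "finite (neighbours E v)"
      using neighbours_finite_simple_graph(1)[OF G] fin by (rule finite_subset)
    have "card (neighbours E v) \<le> max_degree V E"
      unfolding max_degree_def using fin that by (intro Max_ge) auto
    with assms(2) show "card (neighbours E v) \<le> \<Delta>" by simp
  qed (rule neighbours_finite_simple_graph(2)[OF G])
  moreover have "lossless_spmf (persistent_coloring V E \<Delta> f')"
    if v: "v \<in> V" "conflicted E f v" and f'k: "(f', k) \<in> set_spmf (recolor_vertex E \<Delta> v f)" for v f' k
  proof (rule less)
    obtain c where f': "f' = f(v := c)" and ok: "\<not> conflicted E f' v"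
      using recolor_vertex_result[OF f'k] by blast
    have "conflicted E f u" if "conflicted E f' u" for u
    proof -
      obtain x where x: "x \<in> neighbours E u" "f' x = f' u"
        using \<open>conflicted E f' u\<close> by (auto simp: conflicted_def)
      have "u \<noteq> v" using ok that by auto
      moreover have "x \<noteq> v"
        using ok x neighbours_finite_simple_graph(3)[OF G] by (metis conflicted_def)
      ultimately show ?thesis using x by (auto simp: conflicted_def f')
    qed
    then have "{u\<in>V. conflicted E f' u} \<subset> {u\<in>V. conflicted E f u}"
      using v ok by blast
    then show "card {u\<in>V. conflicted E f' u} < card {u\<in>V. conflicted E f u}"
      using fin by (intro psubset_card_mono) auto
  qed
  ultimately show ?case
    using fin by (subst persistent_coloring.simps) auto
qed

(* On a graph of maximum degree at most \<Delta> the algorithm terminates almost surely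
   (lossless_persistent_coloring), so no probability mass is missing from this expectation. *)
definition expected_recolorings ::
    "'a set \<Rightarrow> 'a set set \<Rightarrow> nat \<Rightarrow> ('a \<Rightarrow> nat) \<Rightarrow> ennreal" where
  "expected_recolorings V E \<Delta> f = (\<integral>\<^sup>+ k. of_nat k \<partial>measure_spmf (persistent_coloring V E \<Delta> f))"

end

theory Submission
  imports Defs
begin

text \<open>
  Take \<open>K\<^bsub>\<Delta>,\<Delta>\<^esub>\<close>, colour the left side with the distinct colours \<open>1, \<dots>, \<Delta>\<close> and every
  right vertex with colour \<open>1\<close>. The conflicted vertices are the left vertex of colour \<open>1\<close> and the
  right vertices. A right vertex sees all colours but \<open>\<Delta> + 1\<close>, so settling it costs \<open>\<Delta> + 1\<close>
  recolorings in expectation and leaves the other right vertices conflicted. On average half of the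
  right vertices are chosen before the left vertex of colour \<open>1\<close>, so that the expected cost is at
  least \<open>\<Delta> (\<Delta> + 1) / 2\<close> on \<open>2 \<Delta>\<close> vertices.
\<close>

lemma nn_integral_bind_spmf:
  "(\<integral>\<^sup>+ x. h x \<partial>measure_spmf (bind_spmf p q)) =
   (\<integral>\<^sup>+ y. (\<integral>\<^sup>+ x. h x \<partial>measure_spmf (q y)) \<partial>measure_spmf p)"
  unfolding measure_spmf_bind
  by (subst nn_integral_bind[where B = "count_space UNIV"])
     (auto simp: o_def space_subprob_algebra)

lemma nn_integral_return_spmf:
  "(\<integral>\<^sup>+ x. h x \<partial>measure_spmf (return_spmf y)) = (h y :: ennreal)"
  by (simp add: measure_spmf_return_spmf nn_integral_return)

lemma nn_integral_lossless_add_const: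
  assumes "lossless_spmf p"
  shows "(\<integral>\<^sup>+ x. a + h x \<partial>measure_spmf p) = a + (\<integral>\<^sup>+ x. h x \<partial>measure_spmf p)"
  using assms by (simp add: nn_integral_add lossless_spmf_def weight_spmf_def
    measure_spmf.emeasure_eq_measure)

text \<open>Conditioning on the first chosen vertex. Since the rest of the run is lossless, the
  count \<open>k\<close> of the first vertex leaves the inner integral unchanged, which gives an
  equality.\<close>

lemma expected_recolorings_step:
  assumes G: "finite_simple_graph V E" "max_degree V E \<le> \<Delta>" and "\<exists>v\<in>V. conflicted E f v"
  shows "expected_recolorings V E \<Delta> f =
    (\<Sum>v | v \<in> V \<and> conflicted E f v.
       \<integral>\<^sup>+ (f', k). of_nat k + expected_recolorings V E \<Delta> f' \<partial>measure_spmf (recolor_vertex E \<Delta> v f))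
    / of_nat (card {v\<in>V. conflicted E f v})"
proof -
  let ?C = "{v\<in>V. conflicted E f v}"
  have fin: "finite ?C" and ne: "?C \<noteq> {}"
    using assms by (auto simp: finite_simple_graph_def)
  have "expected_recolorings V E \<Delta> f =
    (\<integral>\<^sup>+ v. (\<integral>\<^sup>+ (f', k). of_nat k + expected_recolorings V E \<Delta> f'
       \<partial>measure_spmf (recolor_vertex E \<Delta> v f)) \<partial>measure_spmf (spmf_of_set ?C))"
    using assms(3) unfolding expected_recolorings_def
    by (subst persistent_coloring.simps)
       (simp add: nn_integral_bind_spmf nn_integral_return_spmf case_prod_unfold
         nn_integral_lossless_add_const[OF lossless_persistent_coloring[OF G]])
  then show ?thesis
    using fin ne by (simp add: nn_integral_spmf_of_set)
qed

text \<open>Conditioning on the first color drawn. The function \<open>h\<close> stands for the cost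
  of everything after \<open>v\<close> is settled; it will be
  \<open>expected_recolorings\<close>.\<close>

lemma nn_integral_recolor_vertex_step:
  assumes "finite (neighbours E v)" "card (neighbours E v) \<le> \<Delta>" "v \<notin> neighbours E v"
    and "conflicted E f v"
  shows "(\<integral>\<^sup>+ (f', k). of_nat k + h f' \<partial>measure_spmf (recolor_vertex E \<Delta> v f)) =
    1 + (\<Sum>c = 1..\<Delta> + 1.
       \<integral>\<^sup>+ (f', k). of_nat k + h f' \<partial>measure_spmf (recolor_vertex E \<Delta> v (f(v := c))))
    / of_nat (\<Delta> + 1)"
proof -
  let ?T = "\<lambda>g. \<integral>\<^sup>+ (f', k). of_nat k + h f' \<partial>measure_spmf (recolor_vertex E \<Delta> v g)"
  have "?T f = (\<integral>\<^sup>+ c. 1 + ?T (f(v := c)) \<partial>measure_spmf (spmf_of_set {1..\<Delta> + 1}))"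
    using assms(4)
    by (subst recolor_vertex.simps)
       (simp add: nn_integral_bind_spmf nn_integral_return_spmf case_prod_unfold add.assoc
         nn_integral_lossless_add_const[OF lossless_recolor_vertex[OF assms(1-3)]] del: of_nat_add)
  also have "\<dots> = 1 + (\<integral>\<^sup>+ c. ?T (f(v := c)) \<partial>measure_spmf (spmf_of_set {1..\<Delta> + 1}))"
    by (rule nn_integral_lossless_add_const) simp
  finally show ?thesis
    by (simp add: nn_integral_spmf_of_set)
qed

text \<open>The number of draws is geometric with success probability
  \<open>1 / (\<Delta> + 1)\<close>, and the final coloring is always \<open>f(v := d)\<close>. A
  lower bound is all that is proved, because \<open>\<top>\<close> can also satisfy the recursion
  for the expectation.\<close>

lemma nn_integral_recolor_vertex_unique_color:
  fixes h :: "('a \<Rightarrow> nat) \<Rightarrow> ennreal"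
  assumes v: "finite (neighbours E v)" "card (neighbours E v) \<le> \<Delta>" "v \<notin> neighbours E v"
    and "conflicted E f v"
    and colors: "\<And>c. c \<in> {1..\<Delta> + 1} \<Longrightarrow> conflicted E (f(v := c)) v \<longleftrightarrow> c \<noteq> d" "d \<in> {1..\<Delta> + 1}"
  shows "of_nat (\<Delta> + 1) + h (f(v := d)) \<le>
    (\<integral>\<^sup>+ (f', k). of_nat k + h f' \<partial>measure_spmf (recolor_vertex E \<Delta> v f))"
proof -
  define T where
    "T g = (\<integral>\<^sup>+ (f', k). of_nat k + h f' \<partial>measure_spmf (recolor_vertex E \<Delta> v g))" for g
  define S where "S = (\<Sum>c = 1..\<Delta> + 1. T (f(v := c)))"
  \<comment> \<open>One step from a conflicted \<open>g\<close> overwrites the color of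
    \<open>v\<close>, so all conflicted colorings that differ from \<open>f\<close> only at
    \<open>v\<close> have the same expectation.\<close>
  have step: "T g = 1 + S / of_nat (\<Delta> + 1)" if "conflicted E g v" "g = f(v := c)" for g c
    using nn_integral_recolor_vertex_step[OF v that(1), of h] that(2) by (simp add: T_def S_def)
  have M: "T f = 1 + S / of_nat (\<Delta> + 1)"
    using step[of f "f v"] assms(4) by simp
  have Td: "T (f(v := d)) = h (f(v := d))"
    using colors by (subst T_def, subst recolor_vertex.simps) (simp add: nn_integral_return_spmf)
  have "S = T (f(v := d)) + (\<Sum>c\<in>{1..\<Delta> + 1} - {d}. T (f(v := c)))"
    unfolding S_def using colors(2) by (intro sum.remove) auto
  also have "(\<Sum>c\<in>{1..\<Delta> + 1} - {d}. T (f(v := c))) = (\<Sum>c\<in>{1..\<Delta> + 1} - {d}. T f)"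
  proof (rule sum.cong[OF refl])
    fix c assume "c \<in> {1..\<Delta> + 1} - {d}"
    then show "T (f(v := c)) = T f"
      unfolding M using colors(1) by (intro step[OF _ refl]) auto
  qed
  also have "\<dots> = of_nat \<Delta> * T f"
    using colors(2) by simp
  finally have S: "S = h (f(v := d)) + of_nat \<Delta> * T f"
    by (simp only: Td)
  \<comment> \<open>Clear the denominator, then cancel \<open>of_nat \<Delta> * T f\<close>; in
    \<open>ennreal\<close> this requires \<open>T f\<close> to be finite.\<close>
  have "of_nat (\<Delta> + 1) * T f = of_nat (\<Delta> + 1) + of_nat (\<Delta> + 1) * (S / of_nat (\<Delta> + 1))"
    by (simp add: M distrib_left del: of_nat_Suc of_nat_add)
  also have "of_nat (\<Delta> + 1) * (S / of_nat (\<Delta> + 1)) = S"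
    by (simp add: ennreal_times_divide mult.commute mult_divide_eq_ennreal del: of_nat_Suc of_nat_add)
  finally have "of_nat \<Delta> * T f + T f = of_nat \<Delta> * T f + (of_nat (\<Delta> + 1) + h (f(v := d)))"
    by (simp add: S algebra_simps)
  then have "of_nat (\<Delta> + 1) + h (f(v := d)) \<le> T f"
  proof (cases "T f = \<top>")
    case False
    then have "of_nat \<Delta> * T f \<noteq> \<top>"
      by (simp add: ennreal_mult_eq_top_iff)
    with \<open>of_nat \<Delta> * T f + T f = _\<close> show ?thesis
      by (metis ennreal_add_left_cancel infinity_ennreal_def order_refl)
  qed simp
  then show ?thesis
    by (simp only: T_def)
qed

definition bipartite_edges :: "nat \<Rightarrow> nat set set" where
  "bipartite_edges \<Delta> = {{u, v} | u v. u < \<Delta> \<and> \<Delta> \<le> v \<and> v < 2 * \<Delta>}"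

text \<open>The coloring reached once the right vertices outside \<open>R\<close> have been settled.\<close>

definition partial_coloring :: "nat \<Rightarrow> nat set \<Rightarrow> nat \<Rightarrow> nat" where
  "partial_coloring \<Delta> R v = (if v < \<Delta> then v + 1 else if v \<in> R then 1 else \<Delta> + 1)"

lemma neighbours_bipartite:
  "neighbours (bipartite_edges \<Delta>) v =
    (if v < \<Delta> then {\<Delta>..<2 * \<Delta>} else if v < 2 * \<Delta> then {..<\<Delta>} else {})"
proof -
  have edge: "{u, v} \<in> bipartite_edges \<Delta> \<longleftrightarrow>
      u < \<Delta> \<and> \<Delta> \<le> v \<and> v < 2 * \<Delta> \<or> v < \<Delta> \<and> \<Delta> \<le> u \<and> u < 2 * \<Delta>" for u
    unfolding bipartite_edges_def by (auto simp: doubleton_eq_iff)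
  show ?thesis
    unfolding neighbours_def edge by auto
qed

lemma finite_simple_graph_bipartite: "finite_simple_graph {..<2 * \<Delta>} (bipartite_edges \<Delta>)"
  by (auto simp: finite_simple_graph_def bipartite_edges_def)

lemma max_degree_bipartite: "max_degree {..<2 * \<Delta>} (bipartite_edges \<Delta>) = \<Delta>"
proof -
  have "(\<lambda>v. card (neighbours (bipartite_edges \<Delta>) v)) ` {..<2 * \<Delta>} = (\<lambda>v. \<Delta>) ` {..<2 * \<Delta>}"
    by (intro image_cong refl) (auto simp: neighbours_bipartite)
  then show ?thesis
    by (cases "\<Delta> = 0") (simp_all add: max_degree_def image_constant_conv lessThan_empty_iff)
qed

text \<open>Settled right vertices have color \<open>\<Delta> + 1\<close>, which is absent on the
  left. The vertices of \<open>R\<close> have color 1, whose only holder on the left is the vertex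
  0; it is conflicted because \<open>R\<close> is nonempty.\<close>

lemma conflicted_partial_coloring:
  assumes "R \<subseteq> {\<Delta>..<2 * \<Delta>}" "R \<noteq> {}"
  shows "{v\<in>{..<2 * \<Delta>}. conflicted (bipartite_edges \<Delta>) (partial_coloring \<Delta> R) v} = insert 0 R"
  using assms by (auto simp: conflicted_def neighbours_bipartite partial_coloring_def split: if_splits)

text \<open>Induction on the number of unsettled right vertices. With \<open>j + 1\<close> of them
  there are \<open>j + 2\<close> equally likely choices. The bound
  \<open>b j = (\<Delta> + 1) * j / 2\<close> solves
  \<open>b (j + 1) = (j + 1) / (j + 2) * (\<Delta> + 1 + b j)\<close>, in which choosing the vertex
  0 is credited with cost 0.\<close>

lemma expected_recolorings_partial_coloring:
  assumes "R \<subseteq> {\<Delta>..<2 * \<Delta>}"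
  shows "ennreal (real (\<Delta> + 1) * card R / 2) \<le>
    expected_recolorings {..<2 * \<Delta>} (bipartite_edges \<Delta>) \<Delta> (partial_coloring \<Delta> R)"
  using assms
proof (induction "card R" arbitrary: R)
  case 0
  then show ?case by simp
next
  case (Suc j)
  let ?V = "{..<2 * \<Delta>}" and ?E = "bipartite_edges \<Delta>"
  let ?X = "expected_recolorings ?V ?E \<Delta>"
  let ?T = "\<lambda>v. \<integral>\<^sup>+ (f', k). of_nat k + ?X f' \<partial>measure_spmf (recolor_vertex ?E \<Delta> v (partial_coloring \<Delta> R))"
  have R: "finite R" "R \<noteq> {}" "0 \<notin> R"
    using Suc.hyps(2) Suc.prems by (auto intro: card_ge_0_finite)
  note C = conflicted_partial_coloring[OF Suc.prems R(2)]
  have T: "ennreal (real (\<Delta> + 1) * (real j + 2) / 2) \<le> ?T v" if "v \<in> R" for v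
  proof -
    have v: "\<Delta> \<le> v" "v < 2 * \<Delta>" using that Suc.prems by auto
    have upd: "(partial_coloring \<Delta> R)(v := \<Delta> + 1) = partial_coloring \<Delta> (R - {v})"
      using v by (auto simp: partial_coloring_def fun_eq_iff)
    \<comment> \<open>A color \<open>c \<le> \<Delta>\<close> is held by the left vertex
      \<open>c - 1\<close>, so \<open>\<Delta> + 1\<close> is the only free color.\<close>
    have sees: "conflicted ?E ((partial_coloring \<Delta> R)(v := c)) v \<longleftrightarrow> c \<noteq> \<Delta> + 1"
      if "c \<in> {1..\<Delta> + 1}" for c
      using v that
      by (auto simp: conflicted_def neighbours_bipartite partial_coloring_def
          intro!: bexI[of _ "c - 1"])
    have "ennreal (real (\<Delta> + 1) * (real j + 2) / 2) =
        of_nat (\<Delta> + 1) + ennreal (real (\<Delta> + 1) * real j / 2)"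
      by (subst ennreal_of_nat_eq_real_of_nat, subst ennreal_plus[symmetric])
         (auto simp: field_simps)
    also have "\<dots> \<le> of_nat (\<Delta> + 1) + ?X ((partial_coloring \<Delta> R)(v := \<Delta> + 1))"
      unfolding upd using Suc.hyps(1)[of "R - {v}"] Suc.hyps(2)[symmetric] Suc.prems that
      by (intro add_left_mono) auto
    also have "\<dots> \<le> ?T v"
      using v that C
      by (intro nn_integral_recolor_vertex_unique_color sees) (auto simp: neighbours_bipartite)
    finally show ?thesis .
  qed
  have cardC: "card (insert 0 R) = j + 2"
    using R Suc.hyps(2) by simp
  have "of_nat (j + 2) * ennreal (real (\<Delta> + 1) * real (card R) / 2)
      = of_nat (card R) * ennreal (real (\<Delta> + 1) * (real j + 2) / 2)"
    unfolding Suc.hyps(2)[symmetric] ennreal_of_nat_eq_real_of_nat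
    by (subst (1 2) ennreal_mult[symmetric]) (auto simp: field_simps)
  also have "\<dots> \<le> (\<Sum>v\<in>R. ?T v)"
    by (rule sum_bounded_below) (rule T)
  \<comment> \<open>The term of the vertex 0 is nonnegative, and no better estimate of it is
    used.\<close>
  also have "\<dots> \<le> (\<Sum>v\<in>insert 0 R. ?T v)"
    using R by (intro sum_mono2) auto
  finally have "of_nat (j + 2) * ennreal (real (\<Delta> + 1) * real (card R) / 2) / of_nat (j + 2)
      \<le> (\<Sum>v\<in>insert 0 R. ?T v) / of_nat (j + 2)"
    by (rule divide_right_mono_ennreal)
  also have "of_nat (j + 2) * ennreal (real (\<Delta> + 1) * real (card R) / 2) / of_nat (j + 2)
      = ennreal (real (\<Delta> + 1) * real (card R) / 2)"
    by (subst mult.commute, rule mult_divide_eq_ennreal) (auto simp del: of_nat_add)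
  also have "(\<Sum>v\<in>insert 0 R. ?T v) / of_nat (j + 2) = ?X (partial_coloring \<Delta> R)"
  proof -
    have "\<exists>v\<in>?V. conflicted ?E (partial_coloring \<Delta> R) v"
      using C by blast
    from expected_recolorings_step[OF finite_simple_graph_bipartite _ this, of \<Delta>] show ?thesis
      unfolding C cardC by (simp add: max_degree_bipartite)
  qed
  finally show ?case .
qed

theorem theorem3:
  shows "\<exists>c::real. c > 0 \<and>
    (\<forall>\<Delta>::nat. \<Delta> \<ge> 2 \<longrightarrow>
      (\<exists>(V :: nat set) (E :: nat set set) (f\<^sub>0 :: nat \<Rightarrow> nat).
         finite_simple_graph V E \<and> max_degree V E = \<Delta> \<and>
         (\<forall>v\<in>V. f\<^sub>0 v \<in> {1..\<Delta> + 1}) \<and>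
         ennreal (c * real (card V) * real \<Delta>) \<le> expected_recolorings V E \<Delta> f\<^sub>0))"
proof (intro exI[of _ "1 / 4"] conjI allI impI)
  fix \<Delta> :: nat
  let ?f = "partial_coloring \<Delta> {\<Delta>..<2 * \<Delta>}"
  \<comment> \<open>With \<open>n = 2 * \<Delta>\<close> vertices, \<open>n * \<Delta> / 4\<close>
    equals \<open>\<Delta> * \<Delta> / 2\<close>, which is at most
    \<open>(\<Delta> + 1) * \<Delta> / 2\<close>.\<close>
  have "ennreal (1 / 4 * real (card {..<2 * \<Delta>}) * real \<Delta>)
      \<le> ennreal (real (\<Delta> + 1) * card {\<Delta>..<2 * \<Delta>} / 2)"
    by (intro ennreal_leI) (simp add: field_simps)
  also have "\<dots> \<le> expected_recolorings {..<2 * \<Delta>} (bipartite_edges \<Delta>) \<Delta> ?f"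
    by (rule expected_recolorings_partial_coloring) simp
  finally show "\<exists>(V :: nat set) (E :: nat set set) (f\<^sub>0 :: nat \<Rightarrow> nat).
      finite_simple_graph V E \<and> max_degree V E = \<Delta> \<and> (\<forall>v\<in>V. f\<^sub>0 v \<in> {1..\<Delta> + 1}) \<and>
      ennreal (1 / 4 * real (card V) * real \<Delta>) \<le> expected_recolorings V E \<Delta> f\<^sub>0"
    using finite_simple_graph_bipartite max_degree_bipartite
    by (intro exI[of _ "{..<2 * \<Delta>}"] exI[of _ "bipartite_edges \<Delta>"] exI[of _ ?f])
       (auto simp: partial_coloring_def)
qed simp

end
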